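(* Let $H$ be a finite-dimensional unimodular Hopf algebra over a field $\Bbbk$. Then the span of all commutators $\operatorname{Com}=\operatorname{span}_{\Bbbk}\{\{a,b\}\mid a,b\in H\}$ is a left coideal of $H$, i.e. $\Delta(\operatorname{Com})\subseteq H\otimes \operatorname{Com}$.
   Context: Sweedler notation: $\Delta(a)=a_1\otimes a_2$; $S$ is the antipode. $H$ is unimodular if its left integrals are also right integrals. A right integral of $H^*$ is $\lambda\in H^*$ with $\lambda(a_1)a_2=\lambda(a)1$ for all $a\in H$. The distinguished group-like element $g\in H$ is determined by $a_1\lambda(a_2)=\lambda(a)g$ for all $a\in H$ (for $\lambda$ a nonzero right integral of $H^*$); for unimodular $H$ one has $S^4(a)=gag^{-1}$. The commutator of $a,b\in H$ is $\{a,b\}:=a_1S^2(b_1)S(a_2)S^{-1}(b_2)g^{-1}$. *)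

theory Defs
  imports "HOL-Library.Poly_Mapping" Complex_Main
begin

section \<open>Tensor powers of a vector space\<close>

text \<open>
  The finitely supported functions from \<open>'x\<close> to \<open>'k\<close> form the free vector space on \<open>'x\<close>;
  \<open>gen x\<close> is the basis vector belonging to \<open>x\<close>.
\<close>

definition free_scale :: "'k::field \<Rightarrow> ('x \<Rightarrow>\<^sub>0 'k) \<Rightarrow> ('x \<Rightarrow>\<^sub>0 'k)" where
  "free_scale c p = Poly_Mapping.map (\<lambda>y. c * y) p"

abbreviation gen :: "'x \<Rightarrow> ('x \<Rightarrow>\<^sub>0 'k::field)" where
  "gen x \<equiv> Poly_Mapping.single x 1"

definition lin_ext ::
  "('k::field \<Rightarrow> 'v::ab_group_add \<Rightarrow> 'v) \<Rightarrow> ('x \<Rightarrow> 'v) \<Rightarrow> ('x \<Rightarrow>\<^sub>0 'k) \<Rightarrow> 'v" where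
  "lin_ext sV f p = (\<Sum>x\<in>Poly_Mapping.keys p. sV (Poly_Mapping.lookup p x) (f x))"

text \<open>
  The scalar multiplication \<open>s\<close> is an ordinary parameter, so the tensor powers cannot be types.
  An element of \<open>H \<otimes> H\<close> is a coset in the free vector space on pairs modulo the usual bilinear
  relations, and an element of \<open>H \<otimes> H \<otimes> H\<close> is a coset in the free vector space on
  triples modulo the trilinear relations.  A slot is a map that fills one tensor factor,
  the others being fixed.
\<close>

definition slot_relations ::
  "('k::field \<Rightarrow> 'h::ab_group_add \<Rightarrow> 'h) \<Rightarrow> ('h \<Rightarrow> 'x) set \<Rightarrow> ('x \<Rightarrow>\<^sub>0 'k) set" where
  "slot_relations s I =
     {gen (i (a + b)) - gen (i a) - gen (i b) | i a b. i \<in> I} \<union>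
     {gen (i (s c a)) - free_scale c (gen (i a)) | i c a. i \<in> I}"

definition slots2 :: "('h \<Rightarrow> 'h \<times> 'h) set" where
  "slots2 = {\<lambda>a. (a, b) | b. True} \<union> {\<lambda>b. (a, b) | a. True}"

definition slots3 :: "('h \<Rightarrow> 'h \<times> 'h \<times> 'h) set" where
  "slots3 = {\<lambda>a. (a, b, c) | b c. True} \<union> {\<lambda>b. (a, b, c) | a c. True}
     \<union> {\<lambda>c. (a, b, c) | a b. True}"

definition coset :: "('x \<Rightarrow>\<^sub>0 'k::field) set \<Rightarrow> ('x \<Rightarrow>\<^sub>0 'k) \<Rightarrow> ('x \<Rightarrow>\<^sub>0 'k) set" where
  "coset R p = {q. q - p \<in> module.span free_scale R}"

definition tens2 ::
  "('k::field \<Rightarrow> 'h::ab_group_add \<Rightarrow> 'h) \<Rightarrow> ('h \<times> 'h \<Rightarrow>\<^sub>0 'k) \<Rightarrow> ('h \<times> 'h \<Rightarrow>\<^sub>0 'k) set" where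
  "tens2 s = coset (slot_relations s slots2)"

definition tens3 ::
  "('k::field \<Rightarrow> 'h::ab_group_add \<Rightarrow> 'h) \<Rightarrow> ('h \<times> 'h \<times> 'h \<Rightarrow>\<^sub>0 'k)
     \<Rightarrow> ('h \<times> 'h \<times> 'h \<Rightarrow>\<^sub>0 'k) set" where
  "tens3 s = coset (slot_relations s slots3)"

definition rep :: "('x \<Rightarrow>\<^sub>0 'k::field) set \<Rightarrow> ('x \<Rightarrow>\<^sub>0 'k)" where
  "rep X = (SOME p. p \<in> X)"

definition tensor_add ::
  "('k::field \<Rightarrow> 'h::ab_group_add \<Rightarrow> 'h) \<Rightarrow> ('h \<times> 'h \<Rightarrow>\<^sub>0 'k) set \<Rightarrow> ('h \<times> 'h \<Rightarrow>\<^sub>0 'k) set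
     \<Rightarrow> ('h \<times> 'h \<Rightarrow>\<^sub>0 'k) set" where
  "tensor_add s X Y = tens2 s (rep X + rep Y)"

definition tensor_scale ::
  "('k::field \<Rightarrow> 'h::ab_group_add \<Rightarrow> 'h) \<Rightarrow> 'k \<Rightarrow> ('h \<times> 'h \<Rightarrow>\<^sub>0 'k) set
     \<Rightarrow> ('h \<times> 'h \<Rightarrow>\<^sub>0 'k) set" where
  "tensor_scale s c X = tens2 s (free_scale c (rep X))"

text \<open>
  For subspaces \<open>V\<close> and \<open>W\<close>, this is \<open>V \<otimes> W\<close> inside \<open>H \<otimes> H\<close>.
\<close>

definition tensor_sub ::
  "('k::field \<Rightarrow> 'h::ab_group_add \<Rightarrow> 'h) \<Rightarrow> 'h set \<Rightarrow> 'h set \<Rightarrow> ('h \<times> 'h \<Rightarrow>\<^sub>0 'k) set set" where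
  "tensor_sub s V W = tens2 s ` module.span free_scale {gen (v, w) | v w. v \<in> V \<and> w \<in> W}"

text \<open>
  For \<open>X\<close> the class of a sum of \<open>x\<^sub>1 \<otimes> x\<^sub>2\<close>, \<open>sweedler sV X f\<close> is the sum of the
  \<open>f x\<^sub>1 x\<^sub>2\<close>, taken in a space with scalar multiplication \<open>sV\<close>.  It is used only where this does
  not depend on the chosen representative: either \<open>f\<close> is bilinear, or \<open>f\<close> has values in a
  free vector space and becomes bilinear in the tensor power to which the sum is sent.
\<close>

definition sweedler ::
  "('k::field \<Rightarrow> 'v::ab_group_add \<Rightarrow> 'v) \<Rightarrow> ('h \<times> 'h \<Rightarrow>\<^sub>0 'k) set \<Rightarrow> ('h \<Rightarrow> 'h \<Rightarrow> 'v) \<Rightarrow> 'v" where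
  "sweedler sV X f = lin_ext sV (\<lambda>(x, y). f x y) (rep X)"


section \<open>Hopf algebras\<close>

text \<open>
  The class \<^class>\<open>ring_1\<close> requires \<open>1 \<noteq> 0\<close>.  This excludes no Hopf algebra, since \<open>\<epsilon> 1 = 1\<close>.
\<close>

locale hopf_algebra = vector_space s
  for s :: "'k::field \<Rightarrow> 'h::ring_1 \<Rightarrow> 'h" +
  fixes \<Delta> :: "'h \<Rightarrow> ('h \<times> 'h \<Rightarrow>\<^sub>0 'k) set"
    and \<epsilon> :: "'h \<Rightarrow> 'k"
    and S :: "'h \<Rightarrow> 'h"
  assumes scale_mult_left: "s c a * b = s c (a * b)"
    and scale_mult_right: "a * s c b = s c (a * b)"
    and comult_in: "\<Delta> a \<in> tensor_sub s UNIV UNIV"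
    and comult_add: "\<Delta> (a + b) = tensor_add s (\<Delta> a) (\<Delta> b)"
    and comult_scale: "\<Delta> (s c a) = tensor_scale s c (\<Delta> a)"
    and counit_linear: "Vector_Spaces.linear s (*) \<epsilon>"
    and coassoc:
      "tens3 s (sweedler free_scale (\<Delta> a)
         (\<lambda>a1 a2. sweedler free_scale (\<Delta> a1) (\<lambda>x y. gen (x, y, a2)))) =
       tens3 s (sweedler free_scale (\<Delta> a)
         (\<lambda>a1 a2. sweedler free_scale (\<Delta> a2) (\<lambda>x y. gen (a1, x, y))))"
    and counit_left: "sweedler s (\<Delta> a) (\<lambda>a1 a2. s (\<epsilon> a1) a2) = a"
    and counit_right: "sweedler s (\<Delta> a) (\<lambda>a1 a2. s (\<epsilon> a2) a1) = a"
    and comult_mult: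
      "\<Delta> (a * b) = tens2 s (sweedler free_scale (\<Delta> a)
         (\<lambda>a1 a2. sweedler free_scale (\<Delta> b) (\<lambda>b1 b2. gen (a1 * b1, a2 * b2))))"
    and comult_one: "\<Delta> 1 = tens2 s (gen (1, 1))"
    and counit_mult: "\<epsilon> (a * b) = \<epsilon> a * \<epsilon> b"
    and counit_one: "\<epsilon> 1 = 1"
    and antipode_linear: "Vector_Spaces.linear s s S"
    and antipode_left: "sweedler s (\<Delta> a) (\<lambda>a1 a2. S a1 * a2) = s (\<epsilon> a) 1"
    and antipode_right: "sweedler s (\<Delta> a) (\<lambda>a1 a2. a1 * S a2) = s (\<epsilon> a) 1"

definition left_integral :: "('k::field \<Rightarrow> 'h::ring_1 \<Rightarrow> 'h) \<Rightarrow> ('h \<Rightarrow> 'k) \<Rightarrow> 'h \<Rightarrow> bool" where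
  "left_integral s \<epsilon> t \<longleftrightarrow> (\<forall>h. h * t = s (\<epsilon> h) t)"

definition right_integral :: "('k::field \<Rightarrow> 'h::ring_1 \<Rightarrow> 'h) \<Rightarrow> ('h \<Rightarrow> 'k) \<Rightarrow> 'h \<Rightarrow> bool" where
  "right_integral s \<epsilon> t \<longleftrightarrow> (\<forall>h. t * h = s (\<epsilon> h) t)"

definition unimodular :: "('k::field \<Rightarrow> 'h::ring_1 \<Rightarrow> 'h) \<Rightarrow> ('h \<Rightarrow> 'k) \<Rightarrow> bool" where
  "unimodular s \<epsilon> \<longleftrightarrow> (\<forall>t. left_integral s \<epsilon> t \<longrightarrow> right_integral s \<epsilon> t)"

definition dual_right_integral ::
  "('k::field \<Rightarrow> 'h::ring_1 \<Rightarrow> 'h) \<Rightarrow> ('h \<Rightarrow> ('h \<times> 'h \<Rightarrow>\<^sub>0 'k) set) \<Rightarrow> ('h \<Rightarrow> 'k) \<Rightarrow> bool" where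
  "dual_right_integral s \<Delta> l \<longleftrightarrow>
     Vector_Spaces.linear s (*) l \<and>
     (\<forall>a. sweedler s (\<Delta> a) (\<lambda>a1 a2. s (l a1) a2) = s (l a) 1)"

definition distinguished_grouplike ::
  "('k::field \<Rightarrow> 'h::ring_1 \<Rightarrow> 'h) \<Rightarrow> ('h \<Rightarrow> ('h \<times> 'h \<Rightarrow>\<^sub>0 'k) set) \<Rightarrow> 'h \<Rightarrow> bool" where
  "distinguished_grouplike s \<Delta> g \<longleftrightarrow>
     (\<exists>l. dual_right_integral s \<Delta> l \<and> l \<noteq> (\<lambda>_. 0) \<and>
       (\<forall>a. sweedler s (\<Delta> a) (\<lambda>a1 a2. s (l a2) a1) = s (l a) g))"

definition ring_inv :: "'h::ring_1 \<Rightarrow> 'h" where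
  "ring_inv g = (THE h. g * h = 1 \<and> h * g = 1)"

text \<open>
  The antipode of a finite-dimensional Hopf algebra is bijective, so \<open>inv S\<close> is its
  two-sided inverse.
\<close>

definition commutator ::
  "('k::field \<Rightarrow> 'h::ring_1 \<Rightarrow> 'h) \<Rightarrow> ('h \<Rightarrow> ('h \<times> 'h \<Rightarrow>\<^sub>0 'k) set) \<Rightarrow> ('h \<Rightarrow> 'h) \<Rightarrow> 'h
     \<Rightarrow> 'h \<Rightarrow> 'h \<Rightarrow> 'h" where
  "commutator s \<Delta> S g a b =
     sweedler s (\<Delta> a) (\<lambda>a1 a2. sweedler s (\<Delta> b) (\<lambda>b1 b2.
       a1 * S (S b1) * S a2 * inv S b2 * ring_inv g))"

definition Com ::
  "('k::field \<Rightarrow> 'h::ring_1 \<Rightarrow> 'h) \<Rightarrow> ('h \<Rightarrow> ('h \<times> 'h \<Rightarrow>\<^sub>0 'k) set) \<Rightarrow> ('h \<Rightarrow> 'h) \<Rightarrow> 'h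
     \<Rightarrow> 'h set" where
  "Com s \<Delta> S g = module.span s {commutator s \<Delta> S g a b | a b. True}"

definition left_coideal ::
  "('k::field \<Rightarrow> 'h::ring_1 \<Rightarrow> 'h) \<Rightarrow> ('h \<Rightarrow> ('h \<times> 'h \<Rightarrow>\<^sub>0 'k) set) \<Rightarrow> 'h set \<Rightarrow> bool" where
  "left_coideal s \<Delta> V \<longleftrightarrow> module.subspace s V \<and> \<Delta> ` V \<subseteq> tensor_sub s UNIV V"

end

theory Submission
  imports Defs
begin

text \<open>
  Write \<open>T\<close> for the inverse of the antipode.  Since \<open>S\<close> and \<open>T\<close> reverse comultiplication and
  \<open>g\<close> is group-like, \<open>\<Delta> {a, b}\<close> is
  \<open>a\<^sub>1 S\<^sup>2(b\<^sub>1) S(a\<^sub>4) T(b\<^sub>4) g\<^sup>-\<^sup>1 \<otimes> a\<^sub>2 S\<^sup>2(b\<^sub>2) S(a\<^sub>3) T(b\<^sub>3) g\<^sup>-\<^sup>1\<close>.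
  The inner legs \<open>a\<^sub>2, a\<^sub>3\<close> and \<open>b\<^sub>2, b\<^sub>3\<close> are the coproducts of a single middle leg of \<open>a\<close> and of
  \<open>b\<close>, so by coassociativity this equals
  \<open>a\<^sub>1 S\<^sup>2(b\<^sub>1) S(a\<^sub>3) T(b\<^sub>3) g\<^sup>-\<^sup>1 \<otimes> {a\<^sub>2, b\<^sub>2}\<close> (\<open>sw_commutator\<close>).
  The second tensor factor is a commutator, which is the assertion.

  Three facts about Hopf algebras enter.  The antipode is anti-multiplicative and
  anti-comultiplicative (\<open>antipode_mult\<close>, \<open>sw_antipode\<close>), by uniqueness of convolution inverses.
  The element \<open>g\<close> is group-like with inverse \<open>S g\<close>
  (\<open>distinguished_grouplike_sw\<close>, \<open>distinguished_grouplike_inverse\<close>), by coassociativity applied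
  to \<open>a\<^sub>1 \<lambda>(a\<^sub>2) = \<lambda>(a) g\<close>.  The antipode is bijective (\<open>antipode_bij\<close>): a nonzero right
  integral \<open>\<lambda>\<close> of the dual satisfies \<open>x\<^sub>1 \<lambda>(S(x\<^sub>2) b) = \<lambda>(S(x) b\<^sub>1) b\<^sub>2\<close> and
  \<open>x\<^sub>1 \<lambda>(S(x\<^sub>3) S\<^sup>2(x\<^sub>2) c) = \<lambda>(c) x\<close>; the first identity forces the left side of the second to
  vanish when \<open>S x = 0\<close>.  So \<open>S\<close> is injective, and hence bijective as the dimension is finite.

  All computations are done with Sweedler sums valued in \<open>H\<close> itself.  An equation in
  \<open>H \<otimes> H\<close> is reduced to such sums by applying \<open>\<phi> \<otimes> id\<close> for all linear functionals \<open>\<phi>\<close>, which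
  jointly separate the elements of \<open>H \<otimes> H\<close> (\<open>tens2_eqI\<close>).
\<close>

section \<open>Free vector spaces and their quotients\<close>

lemma lookup_free_scale: "Poly_Mapping.lookup (free_scale c p) x = c * Poly_Mapping.lookup p x"
  by (simp add: free_scale_def Poly_Mapping.map.rep_eq when_def)

interpretation free: vector_space free_scale
  by standard (auto intro!: poly_mapping_eqI simp: lookup_free_scale lookup_add algebra_simps)

lemma coset_eq_iff: "coset R p = coset R q \<longleftrightarrow> p - q \<in> free.span R"
proof
  assume "coset R p = coset R q"
  then have "p \<in> coset R q"
    by (auto simp: coset_def free.span_zero)
  then show "p - q \<in> free.span R"
    by (simp add: coset_def)
next
  assume d: "p - q \<in> free.span R"
  have "x - p \<in> free.span R \<longleftrightarrow> x - q \<in> free.span R" for x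
    using free.span_add[OF _ d, of "x - p"] free.span_diff[OF _ d, of "x - q"] by auto
  then show "coset R p = coset R q"
    by (auto simp: coset_def)
qed

lemma coset_rep: "coset R (rep (coset R p)) = coset R p"
proof -
  have "p \<in> coset R p"
    by (simp add: coset_def free.span_zero)
  then have "rep (coset R p) \<in> coset R p"
    unfolding rep_def by (rule someI)
  then show ?thesis
    by (simp add: coset_eq_iff) (simp add: coset_def)
qed

context vector_space
begin

text \<open>
  Passing to a common finite superset of the supports is what makes additivity of the linear
  extension a statement about sums over one index set.
\<close>

lemma lin_ext_eq_sum_superset:
  assumes "finite A" "Poly_Mapping.keys p \<subseteq> A"
  shows "lin_ext scale f p = (\<Sum>x\<in>A. scale (Poly_Mapping.lookup p x) (f x))"
  unfolding lin_ext_def using assms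
  by (intro sum.mono_neutral_left) (auto simp: in_keys_iff)

lemma lin_ext_linear: "Vector_Spaces.linear free_scale scale (lin_ext scale f)"
proof -
  have add: "lin_ext scale f (p + q) = lin_ext scale f p + lin_ext scale f q" for p q
  proof -
    let ?A = "Poly_Mapping.keys p \<union> Poly_Mapping.keys q"
    have "lin_ext scale f (p + q) = (\<Sum>x\<in>?A. scale (Poly_Mapping.lookup (p + q) x) (f x))"
      using Poly_Mapping.keys_add[of p q] by (intro lin_ext_eq_sum_superset) auto
    moreover have "lin_ext scale f p = (\<Sum>x\<in>?A. scale (Poly_Mapping.lookup p x) (f x))"
      by (intro lin_ext_eq_sum_superset) auto
    moreover have "lin_ext scale f q = (\<Sum>x\<in>?A. scale (Poly_Mapping.lookup q x) (f x))"
      by (intro lin_ext_eq_sum_superset) auto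
    ultimately show ?thesis
      by (simp add: lookup_add scale_left_distrib sum.distrib)
  qed
  have scale: "lin_ext scale f (free_scale c p) = scale c (lin_ext scale f p)" for c p
  proof -
    have "lin_ext scale f (free_scale c p)
        = (\<Sum>x\<in>Poly_Mapping.keys p. scale (Poly_Mapping.lookup (free_scale c p) x) (f x))"
      by (intro lin_ext_eq_sum_superset) (auto simp: in_keys_iff lookup_free_scale)
    then show ?thesis
      by (simp add: lin_ext_def lookup_free_scale scale_sum_right)
  qed
  show ?thesis
    using add scale by (simp add: Vector_Spaces.linear_iff free.vector_space_axioms vector_space_axioms)
qed

lemma lin_ext_add: "lin_ext scale f (p + q) = lin_ext scale f p + lin_ext scale f q"
  and lin_ext_scale: "lin_ext scale f (free_scale c p) = scale c (lin_ext scale f p)"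
  using lin_ext_linear[of f] by (simp_all add: Vector_Spaces.linear_iff)

lemma lin_ext_diff: "lin_ext scale f (p - q) = lin_ext scale f p - lin_ext scale f q"
  using lin_ext_add[of f "p - q" q] by simp

lemma lin_ext_gen [simp]: "lin_ext scale f (gen x) = f x"
  by (simp add: lin_ext_def)

lemma lin_ext_vanishes_on_span:
  assumes "\<And>r. r \<in> R \<Longrightarrow> lin_ext scale f r = 0" and "p \<in> free.span R"
  shows "lin_ext scale f p = 0"
  using assms(2)
proof (induction rule: free.span_induct_alt)
  case base
  then show ?case by (simp add: lin_ext_def)
next
  case (step c x y)
  then show ?case by (simp add: lin_ext_add lin_ext_scale assms(1))
qed

lemma lin_ext_eq_if_coset_eq:
  assumes "\<And>r. r \<in> R \<Longrightarrow> lin_ext scale f r = 0" and "coset R p = coset R q"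
  shows "lin_ext scale f p = lin_ext scale f q"
proof -
  have "lin_ext scale f (p - q) = 0"
    using assms(2) by (intro lin_ext_vanishes_on_span[OF assms(1)]) (auto simp: coset_eq_iff)
  then show ?thesis by (simp add: lin_ext_diff)
qed

end

text \<open>
  The relations identify \<open>i (\<Sum> c x \<cdot> v x)\<close> with \<open>\<Sum> c x \<cdot> i (v x)\<close>.  The empty sum is included:
  additivity at \<open>0 + 0\<close> shows that a pure tensor with a zero factor is zero.
\<close>

lemma slot_sum:
  assumes i: "i \<in> I" and "finite A"
  shows "gen (i (\<Sum>x\<in>A. s (c x) (v x))) - (\<Sum>x\<in>A. free_scale (c x) (gen (i (v x))))
    \<in> free.span (slot_relations s I)" (is "_ \<in> ?W")
  using \<open>finite A\<close>
proof (induction A rule: finite_induct)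
  case empty
  have "gen (i (0 + 0)) - gen (i 0) - gen (i 0) \<in> ?W"
    using i by (intro free.span_base) (unfold slot_relations_def, blast)
  from free.span_neg[OF this] show ?case
    by simp
next
  case (insert y A)
  let ?r = "\<Sum>x\<in>A. s (c x) (v x)" and ?y = "s (c y) (v y)"
  have "gen (i (?y + ?r)) - gen (i ?y) - gen (i ?r) \<in> ?W"
    "gen (i ?y) - free_scale (c y) (gen (i (v y))) \<in> ?W"
    using i by (auto intro!: free.span_base simp: slot_relations_def) blast+
  from free.span_add[OF free.span_add[OF this] insert.IH] show ?case
    using insert.hyps by (simp add: algebra_simps)
qed

lemma poly_mapping_eq_sum_gen:
  "p = (\<Sum>x\<in>Poly_Mapping.keys p. free_scale (Poly_Mapping.lookup p x) (gen x))"
  by (rule poly_mapping_eqI)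
    (simp add: lookup_sum lookup_free_scale lookup_single when_def in_keys_iff if_distrib sum.delta
      cong: if_cong)

lemma tensor_add_in_tensor_sub:
  fixes s :: "'k::field \<Rightarrow> 'h::ab_group_add \<Rightarrow> 'h"
  assumes "X \<in> tensor_sub s V W" "Y \<in> tensor_sub s V W"
  shows "tensor_add s X Y \<in> tensor_sub s V W"
proof -
  let ?R = "slot_relations s (slots2 :: ('h \<Rightarrow> 'h \<times> 'h) set)"
  let ?B = "free.span {gen (v, w) | v w. v \<in> V \<and> w \<in> W}"
  obtain p q where p: "p \<in> ?B" "X = coset ?R p" and q: "q \<in> ?B" "Y = coset ?R q"
    using assms by (auto simp: tensor_sub_def tens2_def)
  have "rep X - p \<in> free.span ?R" "rep Y - q \<in> free.span ?R"
    unfolding p q by (simp_all add: coset_rep flip: coset_eq_iff)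
  from free.span_add[OF this] have "tensor_add s X Y = coset ?R (p + q)"
    by (simp add: tensor_add_def tens2_def coset_eq_iff algebra_simps)
  then show ?thesis
    using free.span_add[OF p(1) q(1)] by (auto simp: tensor_sub_def tens2_def)
qed

lemma tensor_scale_in_tensor_sub:
  fixes s :: "'k::field \<Rightarrow> 'h::ab_group_add \<Rightarrow> 'h"
  assumes "X \<in> tensor_sub s V W"
  shows "tensor_scale s c X \<in> tensor_sub s V W"
proof -
  let ?R = "slot_relations s (slots2 :: ('h \<Rightarrow> 'h \<times> 'h) set)"
  let ?B = "free.span {gen (v, w) | v w. v \<in> V \<and> w \<in> W}"
  obtain p where p: "p \<in> ?B" "X = coset ?R p"
    using assms by (auto simp: tensor_sub_def tens2_def)
  have "rep X - p \<in> free.span ?R"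
    unfolding p by (simp add: coset_rep flip: coset_eq_iff)
  from free.span_scale[OF this, of c] have "tensor_scale s c X = coset ?R (free_scale c p)"
    by (simp add: tensor_scale_def tens2_def coset_eq_iff free.scale_right_diff_distrib)
  then show ?thesis
    using free.span_scale[OF p(1), of c] by (auto simp: tensor_sub_def tens2_def)
qed

section \<open>Sweedler sums\<close>

lemma sweedler_cong:
  "(\<And>x y. f x y = f' x y) \<Longrightarrow> sweedler sV X f = sweedler sV X f'"
  by (simp add: sweedler_def)

context vector_space
begin

lemma sweedler_add:
  "sweedler scale X (\<lambda>x y. f x y + f' x y) = sweedler scale X f + sweedler scale X f'"
  by (simp add: sweedler_def lin_ext_def case_prod_beta scale_right_distrib sum.distrib)

lemma sweedler_scale:
  "sweedler scale X (\<lambda>x y. scale c (f x y)) = scale c (sweedler scale X f)"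
  by (simp add: sweedler_def lin_ext_def case_prod_beta scale_sum_right mult.commute)

lemma sweedler_sum:
  "sweedler scale X (\<lambda>x y. \<Sum>i\<in>I. f i x y) = (\<Sum>i\<in>I. sweedler scale X (f i))"
  by (simp add: sweedler_def lin_ext_def case_prod_beta scale_sum_right)
    (rule sum.swap)

lemma sweedler_swap:
  "sweedler scale X (\<lambda>x y. sweedler scale Y (\<lambda>u v. f x y u v))
    = sweedler scale Y (\<lambda>u v. sweedler scale X (\<lambda>x y. f x y u v))"
  by (simp add: sweedler_def lin_ext_def case_prod_beta scale_sum_right mult.commute)
    (rule sum.swap)

end

lemma span_sweedler:
  "(\<And>x y. h x y \<in> free.span B) \<Longrightarrow> sweedler free_scale X h \<in> free.span B"
  by (auto simp: sweedler_def lin_ext_def case_prod_beta intro!: free.span_sum free.span_scale)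

lemma linear_sweedler:
  assumes "Vector_Spaces.linear sV sW L"
  shows "L (sweedler sV X f) = sweedler sW X (\<lambda>x y. L (f x y))"
proof -
  interpret Vector_Spaces.linear sV sW L by fact
  show ?thesis by (simp add: sweedler_def lin_ext_def case_prod_beta sum scale)
qed

context hopf_algebra
begin

abbreviation sw where "sw a f \<equiv> sweedler s (\<Delta> a) f"

text \<open>
  \<^const>\<open>Vector_Spaces.linear\<close> is a locale predicate; the bare equations let the simplifier
  discharge linearity side conditions by structural rules.
\<close>

definition lin :: "('h \<Rightarrow> 'h) \<Rightarrow> bool" where
  "lin f \<longleftrightarrow> (\<forall>x y. f (x + y) = f x + f y) \<and> (\<forall>c x. f (s c x) = s c (f x))"

definition bilin :: "('h \<Rightarrow> 'h \<Rightarrow> 'h) \<Rightarrow> bool" where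
  "bilin f \<longleftrightarrow> (\<forall>y. lin (\<lambda>x. f x y)) \<and> (\<forall>x. lin (f x))"

lemma linear_iff_lin: "Vector_Spaces.linear s s f \<longleftrightarrow> lin f"
  by (simp add: lin_def Vector_Spaces.linear_iff vector_space_axioms)

lemma lin_sweedler: "lin L \<Longrightarrow> L (sweedler s X f) = sweedler s X (\<lambda>x y. L (f x y))"
  by (simp add: linear_sweedler flip: linear_iff_lin)

lemma lin_scale: "lin L \<Longrightarrow> L (s c x) = s c (L x)"
  by (simp add: lin_def)

lemma lin_ext_sweedler_free:
  "lin_ext s h (sweedler free_scale X f) = sweedler s X (\<lambda>x y. lin_ext s h (f x y))"
  by (rule linear_sweedler[OF lin_ext_linear])

lemma lin_ext_slot_relations:
  assumes "\<And>i. i \<in> I \<Longrightarrow> lin (\<lambda>x. f (i x))" and "r \<in> slot_relations s I"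
  shows "lin_ext s f r = 0"
  using assms
  by (auto simp: slot_relations_def lin_ext_diff lin_ext_scale lin_def)

lemma lin_ext_slots2:
  assumes "bilin f" and "r \<in> slot_relations s slots2"
  shows "lin_ext s (\<lambda>(x, y). f x y) r = 0"
  by (rule lin_ext_slot_relations[OF _ assms(2)])
    (use assms(1) in \<open>auto simp: slots2_def bilin_def\<close>)

text \<open>
  Bilinearity is exactly what makes a Sweedler sum independent of the representative that
  \<^const>\<open>rep\<close> chooses.
\<close>

lemma sweedler_tens2:
  assumes "bilin f"
  shows "sweedler s (tens2 s p) f = lin_ext s (\<lambda>(x, y). f x y) p"
  unfolding sweedler_def tens2_def
  by (rule lin_ext_eq_if_coset_eq[OF lin_ext_slots2[OF assms]]) (auto simp: coset_rep)

lemma tens2_rep_comult: "tens2 s (rep (\<Delta> a)) = \<Delta> a"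
proof -
  obtain p where "\<Delta> a = tens2 s p"
    using comult_in[of a] by (auto simp: tensor_sub_def)
  then show ?thesis by (simp add: tens2_def coset_rep)
qed

lemma sw_add: "bilin f \<Longrightarrow> sw (a + b) f = sw a f + sw b f"
  by (simp add: comult_add tensor_add_def sweedler_tens2 lin_ext_add) (simp add: sweedler_def)

lemma sw_scale: "bilin f \<Longrightarrow> sw (s c a) f = s c (sw a f)"
  by (simp add: comult_scale tensor_scale_def sweedler_tens2 lin_ext_scale) (simp add: sweedler_def)

lemma lin_sw_arg: "bilin f \<Longrightarrow> lin (\<lambda>a. sw a f)"
  by (simp add: lin_def sw_add sw_scale)

lemma sw_one: "bilin f \<Longrightarrow> sw 1 f = f 1 1"
  by (simp add: comult_one sweedler_tens2)

lemma sw_mult: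
  "bilin f \<Longrightarrow> sw (a * b) f = sw a (\<lambda>a1 a2. sw b (\<lambda>b1 b2. f (a1 * b1) (a2 * b2)))"
  by (simp add: comult_mult sweedler_tens2 lin_ext_sweedler_free)

text \<open>
  Trilinear maps factor through \<open>H \<otimes> H \<otimes> H\<close>, so coassociativity may be used inside every
  Sweedler sum whose summand is linear in each leg.
\<close>

lemma sw_coassoc:
  assumes "\<And>y z. lin (\<lambda>x. F x y z)" "\<And>x z. lin (\<lambda>y. F x y z)" "\<And>x y. lin (\<lambda>z. F x y z)"
  shows "sw a (\<lambda>a1 a2. sw a1 (\<lambda>x y. F x y a2)) = sw a (\<lambda>a1 a2. sw a2 (\<lambda>x y. F a1 x y))"
proof -
  let ?f = "\<lambda>(x, y, z). F x y z"
  have van: "lin_ext s ?f r = 0" if "r \<in> slot_relations s slots3" for r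
    by (rule lin_ext_slot_relations[OF _ that]) (use assms in \<open>auto simp: slots3_def\<close>)
  show ?thesis
    using lin_ext_eq_if_coset_eq[OF van coassoc[of a, unfolded tens3_def]]
    by (simp add: lin_ext_sweedler_free)
qed

lemma sw_counit_left: "lin f \<Longrightarrow> sw a (\<lambda>a1 a2. s (\<epsilon> a1) (f a2)) = f a"
  using lin_sweedler[of f "\<Delta> a" "\<lambda>a1 a2. s (\<epsilon> a1) a2"] by (simp add: counit_left lin_scale)

lemma sw_counit_right: "lin f \<Longrightarrow> sw a (\<lambda>a1 a2. s (\<epsilon> a2) (f a1)) = f a"
  using lin_sweedler[of f "\<Delta> a" "\<lambda>a1 a2. s (\<epsilon> a2) a1"] by (simp add: counit_right lin_scale)

lemma sw_antipode_left: "lin f \<Longrightarrow> sw a (\<lambda>a1 a2. f (S a1 * a2)) = s (\<epsilon> a) (f 1)"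
  using lin_sweedler[of f "\<Delta> a" "\<lambda>a1 a2. S a1 * a2"] by (simp add: antipode_left lin_scale)

lemma sw_antipode_right: "lin f \<Longrightarrow> sw a (\<lambda>a1 a2. f (a1 * S a2)) = s (\<epsilon> a) (f 1)"
  using lin_sweedler[of f "\<Delta> a" "\<lambda>a1 a2. a1 * S a2"] by (simp add: antipode_right lin_scale)

lemma lin_S: "lin F \<Longrightarrow> lin (\<lambda>x. S (F x))"
  using antipode_linear unfolding linear_iff_lin by (simp add: lin_def)

lemma lin_functional: "Vector_Spaces.linear s (*) l \<Longrightarrow> lin F \<Longrightarrow> lin (\<lambda>x. s (l (F x)) c)"
  by (simp add: lin_def Vector_Spaces.linear_iff scale_left_distrib)

lemma bilin_lin:
  assumes "bilin f" "lin G"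
  shows "lin (\<lambda>x. f (G x) c)" "lin (\<lambda>x. f c (G x))"
  using assms by (auto simp: bilin_def lin_def)

text \<open>
  Each leg occurs once in a Sweedler expression, so linearity in it is decided by descending along
  the unique path to that occurrence, one rule for each kind of operation on the path.
\<close>

lemma lin_rules:
  "lin (\<lambda>x. x)"
  "lin F \<Longrightarrow> lin (\<lambda>x. F x * c)"
  "lin F \<Longrightarrow> lin (\<lambda>x. c * F x)"
  "lin F \<Longrightarrow> lin (\<lambda>x. s d (F x))"
  "lin F \<Longrightarrow> lin (\<lambda>x. S (F x))"
  "lin F \<Longrightarrow> lin (\<lambda>x. s (\<epsilon> (F x)) c)"
  "lin F \<Longrightarrow> bilin f \<Longrightarrow> lin (\<lambda>x. sw (F x) f)"
  "(\<And>u v. lin (h u v)) \<Longrightarrow> lin (\<lambda>x. sweedler s X (\<lambda>u v. h u v x))"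
  using lin_S lin_functional[OF counit_linear] lin_sw_arg[of f]
  by (auto simp: lin_def scale_mult_left scale_mult_right algebra_simps sweedler_add sweedler_scale
      scale_right_distrib)

section \<open>The antipode reverses products and coproducts\<close>

lemma antipode_one: "S 1 = 1"
proof -
  have "sw 1 (\<lambda>x y. S x * y) = S 1 * 1"
    by (rule sw_one) (simp add: bilin_def lin_rules)
  then show ?thesis using antipode_left[of 1] by (simp add: counit_one)
qed

text \<open>
  Both \<open>a \<otimes> b \<mapsto> S (a b)\<close> and \<open>a \<otimes> b \<mapsto> S b S a\<close> are convolution inverses of multiplication.
  Concretely, \<open>S (a\<^sub>1 b\<^sub>1) a\<^sub>2 b\<^sub>2 S b\<^sub>3 S a\<^sub>3\<close> collapses from the right to the first and from the
  left to the second.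
\<close>

lemma antipode_mult: "S (a * b) = S b * S a"
proof -
  let ?G = "\<lambda>x1 x2 x3 y1 y2 y3. S (x1 * y1) * (x2 * (y2 * (S y3 * S x3)))"
  have "S (a * b) = sw a (\<lambda>a1 a'. sw a' (\<lambda>a2 a3. sw b (\<lambda>b1 b'. sw b' (\<lambda>b2 b3.
          ?G a1 a2 a3 b1 b2 b3))))" (is "_ = ?M")
  proof -
    have y: "sw y' (\<lambda>y2 y3. ?G x1 x2 x3 y1 y2 y3) = s (\<epsilon> y') (S (x1 * y1) * (x2 * S x3))"
      for x1 x2 x3 y1 y'
      using sw_antipode_right[of "\<lambda>z. S (x1 * y1) * (x2 * (z * S x3))" y']
      by (simp add: lin_rules mult.assoc)
    have x: "sw x' (\<lambda>x2 x3. S (x1 * b) * (x2 * S x3)) = s (\<epsilon> x') (S (x1 * b))" for x1 x'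
      using sw_antipode_right[of "\<lambda>z. S (x1 * b) * z" x'] by (simp add: lin_rules)
    show ?thesis
      by (simp add: y x sw_counit_right lin_rules)
  qed
  also have "?M = sw a (\<lambda>a' a3. sw a' (\<lambda>a1 a2. sw b (\<lambda>b1 b'. sw b' (\<lambda>b2 b3.
          ?G a1 a2 a3 b1 b2 b3))))"
    by (rule sw_coassoc[symmetric]) (simp_all add: lin_rules bilin_def)
  also have "\<dots> = sw a (\<lambda>a' a3. sw a' (\<lambda>a1 a2. sw b (\<lambda>b' b3. sw b' (\<lambda>b1 b2.
          ?G a1 a2 a3 b1 b2 b3))))"
    by (intro sweedler_cong sw_coassoc[symmetric]) (simp_all add: lin_rules bilin_def)
  also have "\<dots> = sw a (\<lambda>a' a3. sw b (\<lambda>b' b3. sw a' (\<lambda>a1 a2. sw b' (\<lambda>b1 b2.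
          ?G a1 a2 a3 b1 b2 b3))))"
    by (intro sweedler_cong sweedler_swap)
  also have "\<dots> = sw a (\<lambda>a' a3. sw b (\<lambda>b' b3. s (\<epsilon> a') (s (\<epsilon> b') (S b3 * S a3))))"
  proof (intro sweedler_cong)
    fix x x3 y y3
    have "sw x (\<lambda>a1 a2. sw y (\<lambda>b1 b2. ?G a1 a2 x3 b1 b2 y3))
        = sw (x * y) (\<lambda>u v. S u * v * (S y3 * S x3))"
      by (simp add: sw_mult lin_rules bilin_def mult.assoc)
    also have "\<dots> = s (\<epsilon> (x * y)) (1 * (S y3 * S x3))"
      by (rule sw_antipode_left) (simp add: lin_rules)
    finally show "sw x (\<lambda>a1 a2. sw y (\<lambda>b1 b2. ?G a1 a2 x3 b1 b2 y3))
        = s (\<epsilon> x) (s (\<epsilon> y) (S y3 * S x3))"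
      by (simp add: counit_mult)
  qed
  also have "\<dots> = S b * S a"
    by (simp add: sweedler_scale sw_counit_left lin_rules del: scale_scale)
  finally show ?thesis .
qed

text \<open>
  Dually, \<open>\<Delta> (S x)\<close> and \<open>S x\<^sub>2 \<otimes> S x\<^sub>1\<close> are both convolution inverses of \<open>\<Delta>\<close>.  The expression
  \<open>G\<close> below is \<open>f\<close> applied to the product \<open>\<Delta>(S x\<^sub>1) \<Delta>(x\<^sub>2) (S x\<^sub>4 \<otimes> S x\<^sub>3)\<close>, evaluated in two ways.
\<close>

lemma sw_antipode:
  assumes f: "bilin f"
  shows "sw (S x) f = sw x (\<lambda>x1 x2. f (S x2) (S x1))"
proof -
  note f_lin = bilin_lin[OF f]
  define G where "G x1 x2 x3 x4 = sw (S x1) (\<lambda>p q. sw x2 (\<lambda>c d. f (p * (c * S x4)) (q * (d * S x3))))"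
    for x1 x2 x3 x4
  have G_lin: "lin (\<lambda>x. G x x2 x3 x4)" "lin (\<lambda>x. G x1 x x3 x4)" "lin (\<lambda>x. G x1 x2 x x4)"
    "lin (\<lambda>x. G x1 x2 x3 x)" for x1 x2 x3 x4
    by (simp_all add: G_def lin_rules f_lin bilin_def)
  have "sw (S x) f = sw x (\<lambda>x1 x'. sw x' (\<lambda>x2 x''. sw x'' (\<lambda>x3 x4. G x1 x2 x3 x4)))" (is "_ = ?M")
  proof -
    have "sw x' (\<lambda>x2 x''. sw x'' (\<lambda>x3 x4. G x1 x2 x3 x4)) = s (\<epsilon> x') (sw (S x1) f)" for x1 x'
    proof -
      have "sw x' (\<lambda>x2 x''. sw x'' (\<lambda>x3 x4. G x1 x2 x3 x4))
        = sw (S x1) (\<lambda>p q. sw x' (\<lambda>x2 x''. sw x'' (\<lambda>x3 x4. sw x2 (\<lambda>c d.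
            f (p * (c * S x4)) (q * (d * S x3))))))"
        unfolding G_def by (simp only: sweedler_swap[where X = "\<Delta> (S x1)"])
      also have "\<dots> = sw (S x1) (\<lambda>p q. s (\<epsilon> x') (f p q))"
      proof (intro sweedler_cong)
        fix p q
        have "sw x' (\<lambda>x2 x''. sw x'' (\<lambda>x3 x4. sw x2 (\<lambda>c d. f (p * (c * S x4)) (q * (d * S x3)))))
          = sw x' (\<lambda>x2 x''. sw x2 (\<lambda>c d. sw x'' (\<lambda>x3 x4. f (p * (c * S x4)) (q * (d * S x3)))))"
          by (intro sweedler_cong sweedler_swap)
        also have "\<dots> = sw x' (\<lambda>c x''. sw x'' (\<lambda>d x'''. sw x''' (\<lambda>x3 x4. f (p * (c * S x4)) (q * (d * S x3)))))"
          by (rule sw_coassoc) (simp_all add: lin_rules f_lin bilin_def)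
        also have "\<dots> = sw x' (\<lambda>c x''. sw x'' (\<lambda>y x4. sw y (\<lambda>d x3. f (p * (c * S x4)) (q * (d * S x3)))))"
          by (intro sweedler_cong sw_coassoc[symmetric]) (simp_all add: lin_rules f_lin bilin_def)
        also have "\<dots> = sw x' (\<lambda>c x''. sw x'' (\<lambda>y x4. s (\<epsilon> y) (f (p * (c * S x4)) q)))"
          using sw_antipode_right[of "\<lambda>z. f (p * (c * S x4)) (q * z)" for c x4]
          by (simp add: lin_rules f_lin)
        also have "\<dots> = sw x' (\<lambda>c x''. f (p * (c * S x'')) q)"
          by (simp add: sw_counit_left lin_rules f_lin)
        also have "\<dots> = s (\<epsilon> x') (f p q)"
          using sw_antipode_right[of "\<lambda>z. f (p * z) q"] by (simp add: lin_rules f_lin)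
        finally show "sw x' (\<lambda>x2 x''. sw x'' (\<lambda>x3 x4. sw x2 (\<lambda>c d. f (p * (c * S x4)) (q * (d * S x3)))))
           = s (\<epsilon> x') (f p q)" .
      qed
      finally show ?thesis by (simp add: sweedler_scale)
    qed
    then show ?thesis by (simp add: sw_counit_right lin_rules f)
  qed
  also have "?M = sw x (\<lambda>x' x''. sw x' (\<lambda>x1 x2. sw x'' (\<lambda>x3 x4. G x1 x2 x3 x4)))"
    by (rule sw_coassoc[symmetric]) (simp_all add: lin_rules G_lin bilin_def)
  also have "\<dots> = sw x (\<lambda>x' x''. s (\<epsilon> x') (sw x'' (\<lambda>x3 x4. f (S x4) (S x3))))"
  proof (intro sweedler_cong)
    fix x' x''
    have "sw x' (\<lambda>x1 x2. G x1 x2 x3 x4) = s (\<epsilon> x') (f (S x4) (S x3))" for x3 x4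
    proof -
      have "sw x' (\<lambda>x1 x2. G x1 x2 x3 x4)
        = sw x' (\<lambda>x1 x2. sw (S x1 * x2) (\<lambda>u v. f (u * S x4) (v * S x3)))"
        by (simp add: G_def sw_mult lin_rules f_lin bilin_def mult.assoc)
      also have "\<dots> = s (\<epsilon> x') (sw 1 (\<lambda>u v. f (u * S x4) (v * S x3)))"
        by (rule sw_antipode_left) (simp add: lin_rules f_lin bilin_def)
      finally show ?thesis by (simp add: sw_one lin_rules f_lin bilin_def)
    qed
    then show "sw x' (\<lambda>x1 x2. sw x'' (\<lambda>x3 x4. G x1 x2 x3 x4))
      = s (\<epsilon> x') (sw x'' (\<lambda>x3 x4. f (S x4) (S x3)))"
      by (subst sweedler_swap) (simp add: sweedler_scale)
  qed
  also have "\<dots> = sw x (\<lambda>x3 x4. f (S x4) (S x3))"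
    by (rule sw_counit_left) (simp add: lin_rules f_lin bilin_def)
  finally show ?thesis .
qed

section \<open>Integrals of the dual and the distinguished group-like element\<close>

text \<open>
  The integral property at \<open>S x\<^sub>2 b\<close> replaces \<open>\<lambda>(S(x\<^sub>2) b)\<close> by
  \<open>S(x\<^sub>2) b\<^sub>2 \<lambda>(S(x\<^sub>3) b\<^sub>1)\<close>; multiplying by \<open>x\<^sub>1\<close> from the left lets \<open>x\<^sub>1 S(x\<^sub>2)\<close> cancel.  The right
  side depends on \<open>x\<close> only through \<open>S x\<close>.
\<close>

lemma sw_integral_antipode:
  assumes l: "dual_right_integral s \<Delta> l"
  shows "sw x (\<lambda>x1 x2. s (l (S x2 * b)) x1) = sw b (\<lambda>b1 b2. s (l (S x * b1)) b2)"
proof -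
  have "Vector_Spaces.linear s (*) l" and int: "\<And>a. sw a (\<lambda>a1 a2. s (l a1) a2) = s (l a) 1"
    using l by (auto simp: dual_right_integral_def fun_eq_iff)
  note l_lin = lin_functional[OF this(1)]
  have "sw x (\<lambda>x1 x2. s (l (S x2 * b)) x1) = sw x (\<lambda>x1 x2. x1 * s (l (S x2 * b)) 1)"
    by (simp add: scale_mult_right)
  also have "\<dots> = sw x (\<lambda>x1 x2. x1 * sw (S x2 * b) (\<lambda>u v. s (l u) v))"
    by (simp only: int)
  also have "\<dots> = sw x (\<lambda>x1 x2. sw x2 (\<lambda>y z. sw b (\<lambda>b1 b2. s (l (S z * b1)) (x1 * S y * b2))))"
    by (simp add: sw_mult sw_antipode lin_sweedler lin_scale mult.assoc lin_rules l_lin bilin_def)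
  also have "\<dots> = sw x (\<lambda>x' z. sw x' (\<lambda>x1 y. sw b (\<lambda>b1 b2. s (l (S z * b1)) (x1 * S y * b2))))"
    by (rule sw_coassoc[symmetric]) (simp_all add: lin_rules l_lin bilin_def)
  also have "\<dots> = sw x (\<lambda>x' z. s (\<epsilon> x') (sw b (\<lambda>b1 b2. s (l (S z * b1)) b2)))"
    using sw_antipode_right[of "\<lambda>w. sw b (\<lambda>b1 b2. s (l (S z * b1)) (w * b2))" for z]
    by (simp add: lin_rules)
  also have "\<dots> = sw b (\<lambda>b1 b2. s (l (S x * b1)) b2)"
    by (rule sw_counit_left) (simp add: lin_rules l_lin)
  finally show ?thesis .
qed

text \<open>
  The legs collapse because \<open>S(x\<^sub>3) S(S(x\<^sub>2)) = S(S(x\<^sub>2) x\<^sub>3)\<close>.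
\<close>

lemma sw_antipode_integral_cancel:
  assumes l: "Vector_Spaces.linear s (*) l"
  shows "sw x (\<lambda>x' x3. sw x' (\<lambda>x1 x2. s (l (S x3 * (S (S x2) * c))) x1)) = s (l c) x"
proof -
  note l_lin = lin_functional[OF l]
  have "sw x (\<lambda>x' x3. sw x' (\<lambda>x1 x2. s (l (S x3 * (S (S x2) * c))) x1))
     = sw x (\<lambda>x1 x'. sw x' (\<lambda>x2 x3. s (l (S x3 * (S (S x2) * c))) x1))"
    by (rule sw_coassoc) (simp_all add: lin_rules l_lin)
  also have "\<dots> = sw x (\<lambda>x1 x'. s (\<epsilon> x') (s (l c) x1))"
    using sw_antipode_left[of "\<lambda>z. s (l (S z * c)) x1" for x1]
    by (simp add: antipode_mult mult.assoc antipode_one lin_rules l_lin)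
  also have "\<dots> = s (l c) x"
    by (rule sw_counit_right) (simp add: lin_rules)
  finally show ?thesis .
qed

text \<open>
  Applying \<open>\<Delta>\<close> to \<open>a\<^sub>1 \<lambda>(a\<^sub>2) = \<lambda>(a) g\<close> gives \<open>a\<^sub>1 \<otimes> a\<^sub>2 \<lambda>(a\<^sub>3) = a\<^sub>1 \<lambda>(a\<^sub>2) \<otimes> g = \<lambda>(a) g \<otimes> g\<close>, and
  applying \<open>\<epsilon>\<close> gives \<open>\<lambda>(a) = \<lambda>(a) \<epsilon>(g)\<close>; \<open>a\<close> is chosen with \<open>\<lambda>(a) \<noteq> 0\<close>.
\<close>

lemma distinguished_grouplike_sw:
  assumes g: "distinguished_grouplike s \<Delta> g"
  shows "bilin f \<Longrightarrow> sw g f = f g g" and "\<epsilon> g = 1"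
proof -
  obtain l where "dual_right_integral s \<Delta> l" and "l \<noteq> (\<lambda>_. 0)"
    and gl: "\<And>a. sw a (\<lambda>a1 a2. s (l a2) a1) = s (l a) g"
    using g unfolding distinguished_grouplike_def by blast
  then obtain a where l: "Vector_Spaces.linear s (*) l" and "l a \<noteq> 0"
    by (auto simp: dual_right_integral_def fun_eq_iff)
  note l_lin = lin_functional[OF l]
  show "sw g f = f g g" if f: "bilin f" for f
  proof -
    note f_lin = bilin_lin[OF f]
    note f_out = f_lin[OF lin_rules(1), THEN lin_sweedler] f_lin[OF lin_rules(1), THEN lin_scale]
    have "s (l a) (sw g f) = sw (s (l a) g) f"
      by (simp add: sw_scale f)
    also have "\<dots> = sw (sw a (\<lambda>a1 a2. s (l a2) a1)) f"
      by (simp only: gl)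
    also have "\<dots> = sw a (\<lambda>a' a3. sw (s (l a3) a') f)"
      by (rule lin_sweedler) (simp add: lin_rules f)
    also have "\<dots> = sw a (\<lambda>a' a3. sw a' (\<lambda>a1 a2. s (l a3) (f a1 a2)))"
      by (simp add: sw_scale f sweedler_scale)
    also have "\<dots> = sw a (\<lambda>a1 a'. sw a' (\<lambda>a2 a3. s (l a3) (f a1 a2)))"
      by (rule sw_coassoc) (simp_all add: lin_rules f_lin l_lin)
    also have "\<dots> = sw a (\<lambda>a1 a'. f a1 (sw a' (\<lambda>a2 a3. s (l a3) a2)))"
      by (simp add: f_out)
    also have "\<dots> = sw a (\<lambda>a1 a'. f (s (l a') a1) g)"
      by (simp add: gl f_out)
    also have "\<dots> = f (sw a (\<lambda>a1 a'. s (l a') a1)) g"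
      by (simp add: f_out)
    also have "\<dots> = s (l a) (f g g)"
      by (simp add: gl f_out)
    finally show ?thesis using \<open>l a \<noteq> 0\<close> by simp
  qed
  have "s (l a * \<epsilon> g) 1 = s (\<epsilon> (s (l a) g)) 1"
    using lin_scale[of "\<lambda>z. s (\<epsilon> z) 1" "l a" g] by (simp add: lin_rules)
  also have "\<dots> = sw a (\<lambda>a1 a2. s (\<epsilon> (s (l a2) a1)) 1)"
    using lin_sweedler[of "\<lambda>z. s (\<epsilon> z) 1" "\<Delta> a" "\<lambda>a1 a2. s (l a2) a1"] by (simp add: gl lin_rules)
  also have "\<dots> = sw a (\<lambda>a1 a2. s (\<epsilon> a1) (s (l a2) 1))"
    using lin_scale[of "\<lambda>z. s (\<epsilon> z) 1"] by (simp add: lin_rules mult.commute)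
  also have "\<dots> = s (l a) 1"
    by (rule sw_counit_left) (simp add: lin_rules l_lin)
  finally show "\<epsilon> g = 1"
    using \<open>l a \<noteq> 0\<close> by simp
qed

lemma distinguished_grouplike_inverse:
  assumes "distinguished_grouplike s \<Delta> g"
  shows "ring_inv g = S g"
proof -
  have "g * S g = 1" "S g * g = 1"
    using antipode_right[of g] antipode_left[of g] distinguished_grouplike_sw[OF assms]
    by (simp_all add: bilin_def lin_rules)
  then show ?thesis
    unfolding ring_inv_def by (intro the_equality) (auto, metis mult.assoc mult.right_neutral mult.left_neutral)
qed

lemma sw_inverse_grouplike:
  assumes "distinguished_grouplike s \<Delta> g" and "bilin f"
  shows "sw (ring_inv g) f = f (ring_inv g) (ring_inv g)"
  using assms distinguished_grouplike_sw(1)[OF assms(1), of "\<lambda>x y. f (S y) (S x)"]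
  by (simp add: distinguished_grouplike_inverse sw_antipode bilin_lin lin_rules bilin_def)

lemma lin_inv_antipode:
  assumes "bij S" "lin F"
  shows "lin (\<lambda>x. inv S (F x))"
proof -
  have "inv S (x + y) = inv S x + inv S y" "inv S (s c x) = s c (inv S x)" for x y c
    using lin_S[OF lin_rules(1)] assms(1)
    by (auto intro!: inv_f_eq simp: bij_is_inj bij_is_surj lin_def surj_f_inv_f)
  then show ?thesis using assms(2) by (simp add: lin_def)
qed

lemma sw_inv_antipode:
  assumes "bij S" "bilin f"
  shows "sw (inv S x) f = sw x (\<lambda>x1 x2. f (inv S x2) (inv S x1))"
proof -
  have "sw (S (inv S x)) (\<lambda>x1 x2. f (inv S x2) (inv S x1)) = sw (inv S x) f"
    using assms by (simp add: sw_antipode bilin_lin lin_inv_antipode lin_rules bilin_def bij_is_inj)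
  then show ?thesis
    using assms(1) by (simp add: bij_is_surj surj_f_inv_f)
qed

end

section \<open>Bijectivity of the antipode in finite dimension\<close>

locale fd_hopf_algebra = hopf_algebra s \<Delta> \<epsilon> S + finite_dimensional_vector_space s Basis
  for s :: "'k::field \<Rightarrow> 'h::ring_1 \<Rightarrow> 'h"
    and \<Delta> :: "'h \<Rightarrow> ('h \<times> 'h \<Rightarrow>\<^sub>0 'k) set"
    and \<epsilon> :: "'h \<Rightarrow> 'k"
    and S :: "'h \<Rightarrow> 'h"
    and Basis :: "'h set"
begin

abbreviation "coord e v \<equiv> representation Basis v e"

lemma linear_coord: "Vector_Spaces.linear s (*) (coord e)"
  by (simp add: Vector_Spaces.linear_iff vector_space_axioms representation_add representation_scale
      independent_Basis span_Basis)
   (unfold_locales, auto simp: algebra_simps)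

lemma sum_coord: "(\<Sum>e\<in>Basis. s (coord e v) e) = v"
  by (simp add: sum_representation_eq independent_Basis span_Basis finite_Basis)

text \<open>
  If \<open>S x = 0\<close>, then \<open>x\<^sub>1 \<lambda>(S(x\<^sub>2) b) = 0\<close> for every fixed \<open>b\<close>.  To reach
  \<open>\<lambda>(c) x = x\<^sub>1 \<lambda>(S(x\<^sub>3) S\<^sup>2(x\<^sub>2) c)\<close> one needs \<open>b\<close> to vary with the leg \<open>x\<^sub>2\<close>.  Expanding
  \<open>S\<^sup>2(x\<^sub>2) c\<close> in a basis moves the dependence on \<open>x\<^sub>2\<close> into scalar coefficients and leaves the
  basis vectors in place of \<open>b\<close>.
\<close>

lemma antipode_bij:
  assumes l: "dual_right_integral s \<Delta> l" and "l \<noteq> (\<lambda>_. 0)"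
  shows "bij S"
proof -
  obtain c where "l c \<noteq> 0" and l_linear: "Vector_Spaces.linear s (*) l"
    using assms by (auto simp: dual_right_integral_def fun_eq_iff)
  note l_lin = lin_functional[OF l_linear]
  interpret l: Vector_Spaces.linear s "(*)" l by (fact l_linear)
  interpret S: Vector_Spaces.linear s s S by (fact antipode_linear)
  have "x = 0" if "S x = 0" for x
  proof -
    have vanish: "sw x (\<lambda>x1 x2. s (l (S x2 * b)) x1) = 0" for b
      using sw_integral_antipode[OF l, of x b] that by (simp add: l.zero sweedler_def lin_ext_def)
    have expand: "s (l (y * w)) z = (\<Sum>e\<in>Basis. s (l (y * e)) (s (coord e w) z))" for y w z
    proof -
      have "l (y * w) = l (y * (\<Sum>e\<in>Basis. s (coord e w) e))"
        by (simp only: sum_coord)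
      then show ?thesis
        by (simp add: sum_distrib_left scale_mult_right l.sum l.scale scale_sum_left mult.commute)
    qed
    have "s (l c) x = sw x (\<lambda>x' x3. sw x' (\<lambda>x1 x2. s (l (S x3 * (S (S x2) * c))) x1))"
      by (simp add: sw_antipode_integral_cancel[OF l_linear])
    also have "\<dots> = (\<Sum>e\<in>Basis. sw x (\<lambda>x' x3. s (l (S x3 * e))
        (sw x' (\<lambda>x1 x2. s (coord e (S (S x2) * c)) x1))))"
      by (subst expand) (simp only: sweedler_sum sweedler_scale)
    also have "\<dots> = (\<Sum>e\<in>Basis. sw (sw x (\<lambda>x' x3. s (l (S x3 * e)) x'))
        (\<lambda>x1 x2. s (coord e (S (S x2) * c)) x1))"
    proof (rule sum.cong)
      fix e
      have "lin (\<lambda>x'. sw x' (\<lambda>x1 x2. s (coord e (S (S x2) * c)) x1))"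
        using lin_functional[OF linear_coord] by (simp add: lin_rules bilin_def)
      note out = lin_sweedler[OF this] lin_scale[OF this]
      show "sw x (\<lambda>x' x3. s (l (S x3 * e)) (sw x' (\<lambda>x1 x2. s (coord e (S (S x2) * c)) x1)))
        = sw (sw x (\<lambda>x' x3. s (l (S x3 * e)) x')) (\<lambda>x1 x2. s (coord e (S (S x2) * c)) x1)"
        by (simp only: out)
    qed simp
    also have "\<dots> = 0"
    proof (intro sum.neutral ballI)
      fix e
      have "bilin (\<lambda>x1 x2. s (coord e (S (S x2) * c)) x1)"
        using lin_functional[OF linear_coord] by (simp add: lin_rules bilin_def)
      then show "sw (sw x (\<lambda>x' x3. s (l (S x3 * e)) x')) (\<lambda>x1 x2. s (coord e (S (S x2) * c)) x1) = 0"
        unfolding vanish using sw_scale[of _ 0 0] by simp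
    qed
    finally show ?thesis using \<open>l c \<noteq> 0\<close> by simp
  qed
  then have "inj S" by (simp add: S.inj_iff_eq_0)
  then show ?thesis
    using linear_inj_imp_surj[OF antipode_linear] by (simp add: bij_def)
qed

section \<open>Separating tensors by functionals\<close>

text \<open>
  Expanding the first factor in the basis \<open>e\<close> turns a representative \<open>d\<close> into
  \<open>\<Sum> e \<otimes> (coord e \<otimes> id) d\<close> modulo the relations, and for the difference \<open>d\<close> of the two
  representatives every coefficient is zero by hypothesis.  The double sum of the terms \<open>?T\<close> is the
  intermediate expression, linked to \<open>d\<close> by linearity in the first factor and to zero by linearity
  in the second.
\<close>

lemma tens2_eqI:
  assumes "\<And>\<phi>. Vector_Spaces.linear s (*) \<phi> \<Longrightarrow>
    lin_ext s (\<lambda>(x, y). s (\<phi> x) y) p = lin_ext s (\<lambda>(x, y). s (\<phi> x) y) q"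
  shows "tens2 s p = tens2 s q"
proof -
  define R where "R = slot_relations s (slots2 :: ('h \<Rightarrow> 'h \<times> 'h) set)"
  define d where "d = p - q"
  let ?K = "Poly_Mapping.keys d"
  let ?T = "\<lambda>e x. free_scale (Poly_Mapping.lookup d x * coord e (fst x)) (gen (e, snd x))"
  have A1: "d - (\<Sum>e\<in>Basis. \<Sum>x\<in>?K. ?T e x) \<in> free.span R"
  proof -
    have "gen x - (\<Sum>e\<in>Basis. free_scale (coord e (fst x)) (gen (e, snd x))) \<in> free.span R" for x
    proof -
      have "(\<lambda>a. (a, snd x)) \<in> slots2"
        by (auto simp: slots2_def)
      from slot_sum[OF this finite_Basis, of s "\<lambda>e. coord e (fst x)" "\<lambda>e. e"] show ?thesis
        by (simp add: R_def sum_coord)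
    qed
    then have "(\<Sum>x\<in>?K. free_scale (Poly_Mapping.lookup d x)
        (gen x - (\<Sum>e\<in>Basis. free_scale (coord e (fst x)) (gen (e, snd x))))) \<in> free.span R"
      by (intro free.span_sum free.span_scale)
    also have "(\<Sum>x\<in>?K. free_scale (Poly_Mapping.lookup d x)
        (gen x - (\<Sum>e\<in>Basis. free_scale (coord e (fst x)) (gen (e, snd x)))))
      = d - (\<Sum>x\<in>?K. \<Sum>e\<in>Basis. ?T e x)"
      by (simp add: free.scale_right_diff_distrib sum_subtractf free.scale_sum_right
          flip: poly_mapping_eq_sum_gen)
    finally show ?thesis by (subst sum.swap)
  qed
  have "(\<Sum>x\<in>?K. ?T e x) \<in> free.span R" for e
  proof -
    have "(\<Sum>x\<in>?K. s (Poly_Mapping.lookup d x * coord e (fst x)) (snd x))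
        = lin_ext s (\<lambda>(x, y). s (coord e x) y) d"
      by (simp add: lin_ext_def case_prod_beta)
    also have "\<dots> = 0"
      using assms[OF linear_coord] by (simp add: d_def lin_ext_diff)
    finally have "gen (e, 0) - (\<Sum>x\<in>?K. ?T e x) \<in> free.span R"
      using slot_sum[of "\<lambda>b. (e, b)" slots2 ?K s "\<lambda>x. Poly_Mapping.lookup d x * coord e (fst x)" snd]
      by (auto simp: R_def slots2_def)
    moreover have "gen (e, 0) \<in> free.span R"
      using slot_sum[of "\<lambda>b. (e, b)" slots2 "{}" s] by (auto simp: R_def slots2_def)
    ultimately show ?thesis
      using free.span_diff by fastforce
  qed
  then have "(\<Sum>e\<in>Basis. \<Sum>x\<in>?K. ?T e x) \<in> free.span R"
    by (rule free.span_sum)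
  from free.span_add[OF A1 this] have d: "d \<in> free.span R"
    by simp
  then show ?thesis
    by (simp add: tens2_def coset_eq_iff d_def R_def)
qed

section \<open>The span of the commutators\<close>

lemma sw_commutator:
  assumes g: "distinguished_grouplike s \<Delta> g" and S: "bij S" and f: "bilin f"
  shows "sw (commutator s \<Delta> S g a b) f =
    sw a (\<lambda>a1 a'. sw a' (\<lambda>a2 a3. sw b (\<lambda>b1 b'. sw b' (\<lambda>b2 b3.
      f (a1 * S (S b1) * S a3 * inv S b3 * ring_inv g) (commutator s \<Delta> S g a2 b2)))))"
proof -
  note rules = lin_rules bilin_lin[OF f] lin_inv_antipode[OF S] bilin_def
  let ?G = "\<lambda>a1 a2 a3 a4 b1 b2 b3 b4.
    f (a1 * S (S b1) * S a4 * inv S b4 * ring_inv g) (a2 * S (S b2) * S a3 * inv S b3 * ring_inv g)"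
  \<comment> \<open>Four legs split as two pairs are regrouped with the middle pair innermost, where the inner
    commutator will appear.\<close>
  have quad: "sw x (\<lambda>x' x''. sw x' (\<lambda>x1 x2. sw x'' (\<lambda>x3 x4. F x1 x2 x3 x4)))
    = sw x (\<lambda>x1 x'. sw x' (\<lambda>x'' x4. sw x'' (\<lambda>x2 x3. F x1 x2 x3 x4)))"
    if F: "\<And>x2 x3 x4. lin (\<lambda>x. F x x2 x3 x4)" "\<And>x1 x3 x4. lin (\<lambda>x. F x1 x x3 x4)"
      "\<And>x1 x2 x4. lin (\<lambda>x. F x1 x2 x x4)" "\<And>x1 x2 x3. lin (\<lambda>x. F x1 x2 x3 x)" for F x
  proof -
    have "sw x (\<lambda>x' x''. sw x' (\<lambda>x1 x2. sw x'' (\<lambda>x3 x4. F x1 x2 x3 x4)))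
      = sw x (\<lambda>x1 x'. sw x' (\<lambda>x2 x''. sw x'' (\<lambda>x3 x4. F x1 x2 x3 x4)))"
      by (rule sw_coassoc) (simp_all add: lin_rules bilin_def F)
    also have "\<dots> = sw x (\<lambda>x1 x'. sw x' (\<lambda>x'' x4. sw x'' (\<lambda>x2 x3. F x1 x2 x3 x4)))"
      by (intro sweedler_cong sw_coassoc[symmetric]) (simp_all add: F)
    finally show ?thesis .
  qed
  have "sw (commutator s \<Delta> S g a b) f
    = sw a (\<lambda>a1 a2. sw b (\<lambda>b1 b2. sw (a1 * S (S b1) * S a2 * inv S b2 * ring_inv g) f))"
    unfolding commutator_def
    by (simp add: lin_sweedler[of "\<lambda>z. sw z f"] lin_sw_arg f)
  also have "\<dots> = sw a (\<lambda>a' a''. sw b (\<lambda>b' b''.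
      sw a' (\<lambda>a1 a2. sw b' (\<lambda>b1 b2. sw a'' (\<lambda>a3 a4. sw b'' (\<lambda>b3 b4. ?G a1 a2 a3 a4 b1 b2 b3 b4))))))"
    by (simp add: sw_mult sw_antipode sw_inv_antipode[OF S] sw_inverse_grouplike[OF g] rules)
  also have "\<dots> = sw a (\<lambda>a' a''. sw a' (\<lambda>a1 a2. sw b (\<lambda>b' b''.
      sw b' (\<lambda>b1 b2. sw a'' (\<lambda>a3 a4. sw b'' (\<lambda>b3 b4. ?G a1 a2 a3 a4 b1 b2 b3 b4))))))"
    by (rule sweedler_cong, rule sweedler_swap)
  also have "\<dots> = sw a (\<lambda>a' a''. sw a' (\<lambda>a1 a2. sw a'' (\<lambda>a3 a4. sw b (\<lambda>b' b''.
      sw b' (\<lambda>b1 b2. sw b'' (\<lambda>b3 b4. ?G a1 a2 a3 a4 b1 b2 b3 b4))))))"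
  proof (rule sweedler_cong, rule sweedler_cong)
    fix a' a'' a1 a2
    have "sw b (\<lambda>b' b''. sw b' (\<lambda>b1 b2. sw a'' (\<lambda>a3 a4. sw b'' (\<lambda>b3 b4. ?G a1 a2 a3 a4 b1 b2 b3 b4))))
      = sw b (\<lambda>b' b''. sw a'' (\<lambda>a3 a4. sw b' (\<lambda>b1 b2. sw b'' (\<lambda>b3 b4. ?G a1 a2 a3 a4 b1 b2 b3 b4))))"
      by (rule sweedler_cong, rule sweedler_swap)
    also have "\<dots> = sw a'' (\<lambda>a3 a4. sw b (\<lambda>b' b''.
        sw b' (\<lambda>b1 b2. sw b'' (\<lambda>b3 b4. ?G a1 a2 a3 a4 b1 b2 b3 b4))))"
      by (rule sweedler_swap)
    finally show "sw b (\<lambda>b' b''. sw b' (\<lambda>b1 b2. sw a'' (\<lambda>a3 a4. sw b'' (\<lambda>b3 b4. ?G a1 a2 a3 a4 b1 b2 b3 b4))))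
      = \<dots>" .
  qed
  also have "\<dots> = sw a (\<lambda>a1 a'. sw a' (\<lambda>a'' a4. sw a'' (\<lambda>a2 a3. sw b (\<lambda>b' b''.
      sw b' (\<lambda>b1 b2. sw b'' (\<lambda>b3 b4. ?G a1 a2 a3 a4 b1 b2 b3 b4))))))"
    by (rule quad) (simp_all add: rules)
  also have "\<dots> = sw a (\<lambda>a1 a'. sw a' (\<lambda>a'' a4. sw a'' (\<lambda>a2 a3. sw b (\<lambda>b1 b'.
      sw b' (\<lambda>b'' b4. sw b'' (\<lambda>b2 b3. ?G a1 a2 a3 a4 b1 b2 b3 b4))))))"
    by (rule sweedler_cong, rule sweedler_cong, rule sweedler_cong, rule quad) (simp_all add: rules)
  also have "\<dots> = sw a (\<lambda>a1 a'. sw a' (\<lambda>a'' a4. sw b (\<lambda>b1 b'. sw a'' (\<lambda>a2 a3.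
      sw b' (\<lambda>b'' b4. sw b'' (\<lambda>b2 b3. ?G a1 a2 a3 a4 b1 b2 b3 b4))))))"
    by (rule sweedler_cong, rule sweedler_cong, rule sweedler_swap)
  also have "\<dots> = sw a (\<lambda>a1 a'. sw a' (\<lambda>a'' a4. sw b (\<lambda>b1 b'. sw b' (\<lambda>b'' b4.
      sw a'' (\<lambda>a2 a3. sw b'' (\<lambda>b2 b3. ?G a1 a2 a3 a4 b1 b2 b3 b4))))))"
    by (rule sweedler_cong, rule sweedler_cong, rule sweedler_cong, rule sweedler_swap)
  finally show ?thesis
    by (simp add: commutator_def lin_sweedler[OF bilin_lin(2)[OF f lin_rules(1)]])
qed

text \<open>
  The element \<open>p\<close> lifts the right side of the preceding formula to the free vector space, where the
  second entry of every generator is visibly a commutator.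
\<close>

lemma comult_commutator:
  assumes g: "distinguished_grouplike s \<Delta> g" and S: "bij S"
  shows "\<Delta> (commutator s \<Delta> S g a b) \<in> tensor_sub s UNIV (Com s \<Delta> S g)"
proof -
  define p where "p = sweedler free_scale (\<Delta> a) (\<lambda>a1 a'. sweedler free_scale (\<Delta> a') (\<lambda>a2 a3.
    sweedler free_scale (\<Delta> b) (\<lambda>b1 b'. sweedler free_scale (\<Delta> b') (\<lambda>b2 b3.
      gen (a1 * S (S b1) * S a3 * inv S b3 * ring_inv g, commutator s \<Delta> S g a2 b2)))))"
  have "\<Delta> (commutator s \<Delta> S g a b) = tens2 s (rep (\<Delta> (commutator s \<Delta> S g a b)))"
    by (simp add: tens2_rep_comult)
  also have "\<dots> = tens2 s p"
  proof (rule tens2_eqI)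
    fix \<phi> assume "Vector_Spaces.linear s (*) \<phi>"
    then have "bilin (\<lambda>x y. s (\<phi> x) y)"
      using lin_functional[OF _ lin_rules(1)] by (simp add: bilin_def lin_rules)
    from sw_commutator[OF g S this]
    show "lin_ext s (\<lambda>(x, y). s (\<phi> x) y) (rep (\<Delta> (commutator s \<Delta> S g a b)))
      = lin_ext s (\<lambda>(x, y). s (\<phi> x) y) p"
      by (simp add: p_def lin_ext_sweedler_free) (simp add: sweedler_def)
  qed
  also have "\<dots> \<in> tensor_sub s UNIV (Com s \<Delta> S g)"
  proof -
    have "commutator s \<Delta> S g a2 b2 \<in> Com s \<Delta> S g" for a2 b2
      unfolding Com_def by (rule span_base) blast
    then show ?thesis
      unfolding tensor_sub_def p_def
      by (intro imageI span_sweedler free.span_base) blast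
  qed
  finally show ?thesis .
qed

lemma left_coideal_Com:
  assumes g: "distinguished_grouplike s \<Delta> g" and S: "bij S"
  shows "left_coideal s \<Delta> (Com s \<Delta> S g)"
proof -
  have "\<Delta> x \<in> tensor_sub s UNIV (Com s \<Delta> S g)" if "x \<in> Com s \<Delta> S g" for x
    using that unfolding Com_def
  proof (induction rule: span_induct_alt)
    case base
    have "\<Delta> 0 = tensor_scale s 0 (\<Delta> (commutator s \<Delta> S g 0 0))"
      by (simp flip: comult_scale)
    then show ?case
      using tensor_scale_in_tensor_sub[OF comult_commutator[OF g S]] by (simp add: Com_def)
  next
    case (step c x y)
    then show ?case
      using comult_commutator[OF g S, unfolded Com_def]
      by (auto simp: comult_add comult_scale
          intro!: tensor_add_in_tensor_sub tensor_scale_in_tensor_sub)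
  qed
  then show ?thesis
    by (auto simp: left_coideal_def Com_def subspace_span)
qed

end

theorem lemma3p2:
  fixes s :: "'k::field \<Rightarrow> 'h::ring_1 \<Rightarrow> 'h"
    and \<Delta> :: "'h \<Rightarrow> ('h \<times> 'h \<Rightarrow>\<^sub>0 'k) set"
    and \<epsilon> :: "'h \<Rightarrow> 'k"
    and S :: "'h \<Rightarrow> 'h"
    and Basis :: "'h set"
    and g :: 'h
  assumes "hopf_algebra s \<Delta> \<epsilon> S"
    and "finite_dimensional_vector_space s Basis"
    and "unimodular s \<epsilon>"
    and "distinguished_grouplike s \<Delta> g"
  shows "left_coideal s \<Delta> (Com s \<Delta> S g)"
proof -
  interpret fd_hopf_algebra s \<Delta> \<epsilon> S Basis
    using assms(1,2) by (rule fd_hopf_algebra.intro)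
  obtain l where "dual_right_integral s \<Delta> l" "l \<noteq> (\<lambda>_. 0)"
    using assms(4) unfolding distinguished_grouplike_def by blast
  then have "bij S"
    by (rule antipode_bij)
  with assms(4) show ?thesis
    by (rule left_coideal_Com)
qed

end
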